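(* Let $\mathcal{W}$ be a von Neumann algebra and let $\mathcal{A}\subset\mathcal{W}$ be a unital subalgebra that admits a Lebesgue decomposition relative to $\mathcal{W}$. Let $\pi:\mathcal{A}\to B(\mathcal{H})$ be a unital contractive homomorphism, and let $\xi\in\mathcal{H}$ be a unit vector that is cyclic for the $\mathrm{C}^*$-algebra generated by $\pi(\mathcal{A})$ and the commutant of $\pi(\mathcal{A})$. Let $\psi:\mathcal{A}\to\mathbb{C}$ be the state defined as $$\psi(a)=\langle\pi(a)\xi,\xi\rangle,\qquad a\in\mathcal{A}.$$ Then $\pi$ is absolutely continuous if and only if $\psi$ is absolutely continuous.
   Context: $\mathcal{H}$ is a Hilbert space. Subalgebras need not be self-adjoint; unital ones contain the identity of $\mathcal{W}$. A bounded linear functional on $\mathcal{A}$ is absolutely continuous (relative to $\mathcal{W}$) if it extends to a weak-$*$ continuous linear functional on $\mathcal{W}$; $\mathrm{AC}_{\mathcal{W}}(\mathcal{A})\subset\mathcal{A}^*$ is the space of these functionals. $\mathcal{A}$ admits a Lebesgue decomposition relative to $\mathcal{W}$ if there is a bounded linear idempotent $L:\mathcal{A}^*\to\mathcal{A}^*$ with $L\mathcal{A}^*=\mathrm{AC}_{\mathcal{W}}(\mathcal{A})$ and $\|\phi\|=\|L\phi\|+\|(I-L)\phi\|$ for all $\phi\in\mathcal{A}^*$. A unital bounded homomorphism $\pi:\mathcal{A}\to B(\mathcal{H})$ is absolutely continuous if for every $x\in\mathcal{H}$ the functional $a\mapsto\langle\pi(a)x,x\rangle$ on $\mathcal{A}$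 is absolutely continuous relative to $\mathcal{W}$. *)

theory Defs
  imports "HOL-Analysis.Analysis"
begin

section \<open>Complex Hilbert spaces\<close>

text \<open>
  A complex Hilbert space is built on top of the library class of real inner product spaces: the
  real inner product is the real part of the complex one, so that norm, topology and completeness
  are the library's. The complex inner product is linear in its \<^emph>\<open>first\<close> argument.
\<close>

class chilbert_space = real_inner + complete_space +
  fixes scaleC :: "complex \<Rightarrow> 'a \<Rightarrow> 'a" (infixr \<open>*\<^sub>C\<close> 75)
    and cinner :: "'a \<Rightarrow> 'a \<Rightarrow> complex"
  assumes scaleC_add_right: "c *\<^sub>C (x + y) = c *\<^sub>C x + c *\<^sub>C y"
    and scaleC_add_left: "(c + d) *\<^sub>C x = c *\<^sub>C x + d *\<^sub>C x"
    and scaleC_scaleC: "c *\<^sub>C d *\<^sub>C x = (c * d) *\<^sub>C x"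
    and scaleR_scaleC: "scaleR r x = complex_of_real r *\<^sub>C x"
    and cinner_commute: "cinner x y = cnj (cinner y x)"
    and cinner_add_left: "cinner (x + y) z = cinner x z + cinner y z"
    and cinner_scaleC_left: "cinner (c *\<^sub>C x) y = c * cinner x y"
    and inner_eq_Re_cinner: "inner x y = Re (cinner x y)"

instance chilbert_space \<subseteq> banach ..

lemma norm_scaleC:
  fixes x :: "'a::chilbert_space"
  shows "norm (c *\<^sub>C x) = cmod c * norm x"
proof -
  have right: "cinner y (d *\<^sub>C z) = cnj d * cinner y z" for y z :: 'a and d
    by (metis cinner_commute cinner_scaleC_left complex_cnj_mult)
  have "inner (c *\<^sub>C x) (c *\<^sub>C x) = (cmod c)\<^sup>2 * inner x x"
  proof -
    have "cinner (c *\<^sub>C x) (c *\<^sub>C x) = of_real ((cmod c)\<^sup>2) * cinner x x"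
      by (simp only: right cinner_scaleC_left complex_norm_square) (simp add: mult_ac)
    thus ?thesis by (simp add: inner_eq_Re_cinner del: of_real_power)
  qed
  thus ?thesis by (simp add: norm_eq_sqrt_inner real_sqrt_mult)
qed

instantiation complex :: chilbert_space
begin
definition scaleC_complex :: "complex \<Rightarrow> complex \<Rightarrow> complex" where "scaleC_complex c x = c * x"
definition cinner_complex :: "complex \<Rightarrow> complex \<Rightarrow> complex" where "cinner_complex x y = x * cnj y"
instance
  by standard
    (auto simp: scaleC_complex_def cinner_complex_def algebra_simps inner_complex_def scaleR_conv_of_real)
end

section \<open>Algebras of operators\<close>

text \<open>
  The library type of bounded operators consists of the \<^emph>\<open>real\<close>-linear ones; \<open>B(H)\<close> is the set of
  those that are complex linear. The library norm is the operator norm.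
\<close>

definition bounded_ops :: "('h::chilbert_space \<Rightarrow>\<^sub>L 'h) set" where
  "bounded_ops = {T. \<forall>c x. blinfun_apply T (c *\<^sub>C x) = c *\<^sub>C blinfun_apply T x}"

lift_definition scaleC_op :: "complex \<Rightarrow> ('h::chilbert_space \<Rightarrow>\<^sub>L 'h) \<Rightarrow> ('h \<Rightarrow>\<^sub>L 'h)"
  is "\<lambda>c T x. c *\<^sub>C T x"
proof -
  fix c :: complex and T :: "'h \<Rightarrow> 'h"
  assume T: "bounded_linear T"
  have "bounded_linear (\<lambda>x::'h. c *\<^sub>C x)"
    by (rule bounded_linear_intro[where K = "cmod c"])
      (simp_all add: scaleC_add_right scaleR_scaleC scaleC_scaleC norm_scaleC mult.commute)
  from bounded_linear_compose[OF this T] show "bounded_linear (\<lambda>x. c *\<^sub>C T x)" .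
qed

definition subalgebra :: "('h::chilbert_space \<Rightarrow>\<^sub>L 'h) set \<Rightarrow> bool" where
  "subalgebra A \<longleftrightarrow> A \<subseteq> bounded_ops \<and> 0 \<in> A \<and>
     (\<forall>a\<in>A. \<forall>b\<in>A. a + b \<in> A \<and> a o\<^sub>L b \<in> A) \<and> (\<forall>c. \<forall>a\<in>A. scaleC_op c a \<in> A)"

definition unital_subalgebra :: "('h::chilbert_space \<Rightarrow>\<^sub>L 'h) set \<Rightarrow> bool" where
  "unital_subalgebra A \<longleftrightarrow> subalgebra A \<and> id_blinfun \<in> A"

definition is_adjoint :: "('h::chilbert_space \<Rightarrow>\<^sub>L 'h) \<Rightarrow> ('h \<Rightarrow>\<^sub>L 'h) \<Rightarrow> bool" where
  "is_adjoint T S \<longleftrightarrow> (\<forall>x y. cinner (T x) y = cinner x (S y))"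

definition self_adjoint_set :: "('h::chilbert_space \<Rightarrow>\<^sub>L 'h) set \<Rightarrow> bool" where
  "self_adjoint_set A \<longleftrightarrow> (\<forall>T\<in>A. \<exists>S\<in>A. is_adjoint T S)"

definition cstar_subalgebra :: "('h::chilbert_space \<Rightarrow>\<^sub>L 'h) set \<Rightarrow> bool" where
  "cstar_subalgebra A \<longleftrightarrow> subalgebra A \<and> self_adjoint_set A \<and> closed A"

definition cstar_generated :: "('h::chilbert_space \<Rightarrow>\<^sub>L 'h) set \<Rightarrow> ('h \<Rightarrow>\<^sub>L 'h) set" where
  "cstar_generated M = \<Inter> {B. cstar_subalgebra B \<and> M \<subseteq> B}"

definition commutant :: "('h::chilbert_space \<Rightarrow>\<^sub>L 'h) set \<Rightarrow> ('h \<Rightarrow>\<^sub>L 'h) set" where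
  "commutant M = {T \<in> bounded_ops. \<forall>S\<in>M. T o\<^sub>L S = S o\<^sub>L T}"

definition cyclic_vector :: "('h::chilbert_space \<Rightarrow>\<^sub>L 'h) set \<Rightarrow> 'h \<Rightarrow> bool" where
  "cyclic_vector B x \<longleftrightarrow> closure ((\<lambda>T. blinfun_apply T x) ` B) = UNIV"

text \<open>
  Von Neumann algebras are represented concretely. For convex sets, closedness in the strong and in
  the weak operator topology coincide.
\<close>

definition von_neumann_algebra :: "('h::chilbert_space \<Rightarrow>\<^sub>L 'h) set \<Rightarrow> bool" where
  "von_neumann_algebra W \<longleftrightarrow> unital_subalgebra W \<and> self_adjoint_set W \<and>
     closedin (subtopology strong_operator_topology bounded_ops) W"

section \<open>The weak-* topology\<close>

text \<open>
  The predual of \<open>B(H)\<close> (the trace class operators) acts on \<open>B(H)\<close> by the functionals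
  \<open>T \<mapsto> \<Sum>n. \<langle>T x\<^sub>n, y\<^sub>n\<rangle>\<close> with square-summable sequences \<open>x\<close> and \<open>y\<close>. The weak-* topology of a von
  Neumann algebra \<open>W\<close> is the restriction to \<open>W\<close> of the topology on \<open>B(H)\<close> induced by them.
\<close>

definition square_summable :: "(nat \<Rightarrow> 'h::chilbert_space) \<Rightarrow> bool" where
  "square_summable x \<longleftrightarrow> summable (\<lambda>n. (norm (x n))\<^sup>2)"

definition predual_functional ::
    "(nat \<Rightarrow> 'h::chilbert_space) \<Rightarrow> (nat \<Rightarrow> 'h) \<Rightarrow> ('h \<Rightarrow>\<^sub>L 'h) \<Rightarrow> complex" where
  "predual_functional x y T = (\<Sum>n. cinner (T (x n)) (y n))"

definition ultraweak_topology :: "('h::chilbert_space \<Rightarrow>\<^sub>L 'h) topology" where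
  "ultraweak_topology = topology_generated_by
     {{T \<in> bounded_ops. predual_functional x y T \<in> U} | x y U.
        square_summable x \<and> square_summable y \<and> open U}"

definition weak_star_topology :: "('h::chilbert_space \<Rightarrow>\<^sub>L 'h) set \<Rightarrow> ('h \<Rightarrow>\<^sub>L 'h) topology" where
  "weak_star_topology W = subtopology ultraweak_topology W"

section \<open>Functionals\<close>

definition linear_functional_on ::
    "('h::chilbert_space \<Rightarrow>\<^sub>L 'h) set \<Rightarrow> (('h \<Rightarrow>\<^sub>L 'h) \<Rightarrow> complex) \<Rightarrow> bool" where
  "linear_functional_on A \<phi> \<longleftrightarrow> (\<forall>a\<in>A. \<forall>b\<in>A. \<phi> (a + b) = \<phi> a + \<phi> b) \<and>
     (\<forall>c. \<forall>a\<in>A. \<phi> (scaleC_op c a) = c * \<phi> a)"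

definition bounded_functional_on ::
    "('h::chilbert_space \<Rightarrow>\<^sub>L 'h) set \<Rightarrow> (('h \<Rightarrow>\<^sub>L 'h) \<Rightarrow> complex) \<Rightarrow> bool" where
  "bounded_functional_on A \<phi> \<longleftrightarrow> linear_functional_on A \<phi> \<and> (\<exists>K. \<forall>a\<in>A. cmod (\<phi> a) \<le> K * norm a)"

text \<open>Elements of the dual space of \<open>A\<close> are represented by functions that vanish outside \<open>A\<close>.\<close>

definition dual_space ::
    "('h::chilbert_space \<Rightarrow>\<^sub>L 'h) set \<Rightarrow> (('h \<Rightarrow>\<^sub>L 'h) \<Rightarrow> complex) set" where
  "dual_space A = {\<phi>. bounded_functional_on A \<phi> \<and> (\<forall>a. a \<notin> A \<longrightarrow> \<phi> a = 0)}"

definition dual_norm ::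
    "('h::chilbert_space \<Rightarrow>\<^sub>L 'h) set \<Rightarrow> (('h \<Rightarrow>\<^sub>L 'h) \<Rightarrow> complex) \<Rightarrow> real" where
  "dual_norm A \<phi> = (SUP a\<in>{a \<in> A. norm a \<le> 1}. cmod (\<phi> a))"

text \<open>This depends only on the values of \<open>\<phi>\<close> on \<open>A\<close>.\<close>

definition abs_continuous_functional ::
    "('h::chilbert_space \<Rightarrow>\<^sub>L 'h) set \<Rightarrow> ('h \<Rightarrow>\<^sub>L 'h) set \<Rightarrow> (('h \<Rightarrow>\<^sub>L 'h) \<Rightarrow> complex) \<Rightarrow> bool" where
  "abs_continuous_functional W A \<phi> \<longleftrightarrow> bounded_functional_on A \<phi> \<and>
     (\<exists>\<omega>. linear_functional_on W \<omega> \<and> continuous_map (weak_star_topology W) euclidean \<omega> \<and>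
          (\<forall>a\<in>A. \<omega> a = \<phi> a))"

definition AC_space ::
    "('h::chilbert_space \<Rightarrow>\<^sub>L 'h) set \<Rightarrow> ('h \<Rightarrow>\<^sub>L 'h) set \<Rightarrow> (('h \<Rightarrow>\<^sub>L 'h) \<Rightarrow> complex) set" where
  "AC_space W A = {\<phi> \<in> dual_space A. abs_continuous_functional W A \<phi>}"

definition bounded_linear_map_on_dual ::
    "('h::chilbert_space \<Rightarrow>\<^sub>L 'h) set \<Rightarrow>
      ((('h \<Rightarrow>\<^sub>L 'h) \<Rightarrow> complex) \<Rightarrow> (('h \<Rightarrow>\<^sub>L 'h) \<Rightarrow> complex)) \<Rightarrow> bool" where
  "bounded_linear_map_on_dual A L \<longleftrightarrow>
     L ` dual_space A \<subseteq> dual_space A \<and>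
     (\<forall>\<phi>\<in>dual_space A. \<forall>\<psi>\<in>dual_space A. L (\<lambda>a. \<phi> a + \<psi> a) = (\<lambda>a. L \<phi> a + L \<psi> a)) \<and>
     (\<forall>c. \<forall>\<phi>\<in>dual_space A. L (\<lambda>a. c * \<phi> a) = (\<lambda>a. c * L \<phi> a)) \<and>
     (\<exists>K. \<forall>\<phi>\<in>dual_space A. dual_norm A (L \<phi>) \<le> K * dual_norm A \<phi>)"

definition admits_lebesgue_decomposition ::
    "('h::chilbert_space \<Rightarrow>\<^sub>L 'h) set \<Rightarrow> ('h \<Rightarrow>\<^sub>L 'h) set \<Rightarrow> bool" where
  "admits_lebesgue_decomposition W A \<longleftrightarrow>
     (\<exists>L. bounded_linear_map_on_dual A L \<and>
          (\<forall>\<phi>\<in>dual_space A. L (L \<phi>) = L \<phi>) \<and>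
          L ` dual_space A = AC_space W A \<and>
          (\<forall>\<phi>\<in>dual_space A.
             dual_norm A \<phi> = dual_norm A (L \<phi>) + dual_norm A (\<lambda>a. \<phi> a - L \<phi> a)))"

section \<open>Representations\<close>

definition unital_homomorphism ::
    "('k::chilbert_space \<Rightarrow>\<^sub>L 'k) set \<Rightarrow> (('k \<Rightarrow>\<^sub>L 'k) \<Rightarrow> ('h::chilbert_space \<Rightarrow>\<^sub>L 'h)) \<Rightarrow> bool" where
  "unital_homomorphism A \<pi> \<longleftrightarrow> \<pi> ` A \<subseteq> bounded_ops \<and> \<pi> id_blinfun = id_blinfun \<and>
     (\<forall>a\<in>A. \<forall>b\<in>A. \<pi> (a + b) = \<pi> a + \<pi> b \<and> \<pi> (a o\<^sub>L b) = \<pi> a o\<^sub>L \<pi> b) \<and>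
     (\<forall>c. \<forall>a\<in>A. \<pi> (scaleC_op c a) = scaleC_op c (\<pi> a))"

definition contractive_on ::
    "('k::chilbert_space \<Rightarrow>\<^sub>L 'k) set \<Rightarrow> (('k \<Rightarrow>\<^sub>L 'k) \<Rightarrow> ('h::chilbert_space \<Rightarrow>\<^sub>L 'h)) \<Rightarrow> bool" where
  "contractive_on A \<pi> \<longleftrightarrow> (\<forall>a\<in>A. norm (\<pi> a) \<le> norm a)"

definition abs_continuous_rep ::
    "('k::chilbert_space \<Rightarrow>\<^sub>L 'k) set \<Rightarrow> ('k \<Rightarrow>\<^sub>L 'k) set \<Rightarrow>
      (('k \<Rightarrow>\<^sub>L 'k) \<Rightarrow> ('h::chilbert_space \<Rightarrow>\<^sub>L 'h)) \<Rightarrow> bool" where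
  "abs_continuous_rep W A \<pi> \<longleftrightarrow> (\<forall>x. abs_continuous_functional W A (\<lambda>a. cinner (\<pi> a x) x))"

end

theory Submission
  imports Defs
begin

text \<open>
  For vectors \<open>x\<close> and \<open>y\<close> let \<open>\<phi>\<^sub>x\<^sub>y(a) = \<langle>\<pi>(a)x, y\<rangle>\<close>, and let \<open>\<sigma>\<^sub>x\<^sub>y = (I - L)\<phi>\<^sub>x\<^sub>y\<close> be its singular part,
  so that \<open>\<phi>\<^sub>x\<^sub>y\<close> is absolutely continuous exactly when \<open>\<sigma>\<^sub>x\<^sub>y = 0\<close>. One direction of the theorem is
  immediate. For the other one, the vectors \<open>x\<close> with absolutely continuous \<open>\<phi>\<^sub>x\<^sub>x\<close> are shown to form a
  closed subspace that is reducing for \<open>\<pi>(A)\<close> and its commutant. It contains \<open>\<xi>\<close>, hence the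
  closure of the orbit of \<open>\<xi>\<close> under the generated C*-algebra, which is the whole space.

  Linearity and reducibility both rest on a stronger property: if \<open>\<phi>\<^sub>x\<^sub>x\<close> is absolutely continuous, then
  so are \<open>\<phi>\<^sub>x\<^sub>y\<close> and \<open>\<phi>\<^sub>y\<^sub>x\<close> for \<^emph>\<open>every\<close> \<open>y\<close> (\<open>ac_vectorsI\<close>). This is where the additivity of the norm
  enters. Since \<open>\<pi>\<close> is unital and contractive, \<open>\<parallel>\<phi>\<^sub>z\<^sub>z\<parallel> = \<phi>\<^sub>z\<^sub>z(1)\<close>; because the norms of the two parts of
  \<open>\<phi>\<^sub>z\<^sub>z\<close> add up to this number, each part must attain its norm at \<open>1\<close>, as a positive functional does.
  So \<open>\<bar>\<sigma>\<^sub>z\<^sub>z(a)\<bar> \<le> \<parallel>a\<parallel> \<sigma>\<^sub>z\<^sub>z(1)\<close> for all \<open>z\<close>: the sesquilinear form \<open>(x, y) \<mapsto> \<sigma>\<^sub>x\<^sub>y(a)\<close> is dominated on the diagonal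
  by the form \<open>(x, y) \<mapsto> \<sigma>\<^sub>x\<^sub>y(1)\<close>, and by polarization it vanishes as soon as one of its arguments is a null
  vector of the latter (\<open>dominated_sesquilinear_left_null\<close>).

  The subspace is closed because \<open>\<sigma>\<^sub>x\<^sub>y(a)\<close> is continuous in \<open>x\<close> and \<open>y\<close>. It is invariant because
  \<open>\<langle>\<pi>(b)\<pi>(a)x, \<pi>(a)x\<rangle> = \<phi>\<^sub>x\<^sub>y(ba)\<close> with \<open>y = \<pi>(a)x\<close>, and left and right translates of absolutely
  continuous functionals are absolutely continuous; similar identities, all of them with \<open>x\<close> in
  one argument, cover \<open>\<pi>(a)*\<close>, elements \<open>T\<close> of the commutant (with \<open>y = T*Tx\<close>) and their adjoints.
\<close>

section \<open>Complex inner products\<close>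

lemma cinner_add_right: "cinner x (y + z) = cinner x y + cinner x z"
  by (metis cinner_add_left cinner_commute complex_cnj_add)

lemma cinner_scaleC_right: "cinner x (c *\<^sub>C y) = cnj c * cinner x y"
  by (metis cinner_commute cinner_scaleC_left complex_cnj_mult)

lemma scaleC_minus_one: "(-1) *\<^sub>C x = - (x::'a::chilbert_space)"
  using scaleR_scaleC[of "-1" x] by simp

lemma cinner_minus_left: "cinner (- x) y = - cinner x y"
  using cinner_scaleC_left[of "-1" x y] by (simp add: scaleC_minus_one)

lemma cinner_minus_right: "cinner x (- y) = - cinner x y"
  using cinner_scaleC_right[of x "-1" y] by (simp add: scaleC_minus_one)

lemma cinner_diff_left: "cinner (x - y) z = cinner x z - cinner y z"
  using cinner_add_left[of x "- y" z] by (simp add: cinner_minus_left)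

lemma cinner_diff_right: "cinner x (y - z) = cinner x y - cinner x z"
  using cinner_add_right[of x y "- z"] by (simp add: cinner_minus_right)

lemma cinner_zero_left: "cinner 0 x = 0"
  using cinner_diff_left[of 0 0 x] by simp

lemma cinner_zero_right: "cinner x 0 = 0"
  using cinner_diff_right[of x 0 0] by simp

lemma cinner_self: "cinner x x = of_real ((norm x)\<^sup>2)"
proof -
  have "Im (cinner x x) = 0"
    using arg_cong[OF cinner_commute[of x x], of Im] by simp
  moreover have "Re (cinner x x) = (norm x)\<^sup>2"
    by (simp add: inner_eq_Re_cinner[symmetric] dot_square_norm)
  ultimately show ?thesis by (simp add: complex_eq_iff del: of_real_power)
qed

text \<open>A unimodular multiple of \<open>x\<close> makes the complex inner product real, which reduces the inequality
  to the real Cauchy-Schwarz inequality.\<close>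

lemma cmod_cinner_le: "cmod (cinner x y) \<le> norm x * norm y"
proof (cases "cinner x y = 0")
  case False
  define u where "u = cnj (cinner x y) / of_real (cmod (cinner x y))"
  have u: "cmod u = 1" using False by (simp add: u_def norm_divide)
  have "u * cinner x y = of_real (cmod (cinner x y))"
    using False complex_norm_square[of "cinner x y"]
    by (simp add: u_def field_simps power2_eq_square)
  hence "cmod (cinner x y) = inner (u *\<^sub>C x) y"
    by (simp add: inner_eq_Re_cinner cinner_scaleC_left)
  also have "\<dots> \<le> norm (u *\<^sub>C x) * norm y" by (rule norm_cauchy_schwarz)
  finally show ?thesis by (simp add: norm_scaleC u)
qed simp

lemma inner_extensionality:
  assumes "\<And>z. inner z x = inner z y"
  shows "x = y"
  using assms[of "x - y"] by (metis inner_diff_right inner_eq_zero_iff right_minus_eq)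

section \<open>Adjoints\<close>

text \<open>The functional \<open>J(x) = \<parallel>x\<parallel>\<^sup>2 / 2 - f(x)\<close> is bounded below and, by the parallelogram law, strongly
  convex, so that minimizing sequences are Cauchy. At the minimizer \<open>y\<close> the directional derivatives
  \<open>\<langle>x, y\<rangle> - f(x)\<close> of \<open>J\<close> vanish.\<close>

lemma riesz_representation:
  fixes f :: "'a::{real_inner, complete_space} \<Rightarrow> real"
  assumes f: "bounded_linear f"
  shows "\<exists>y. \<forall>x. f x = inner x y"
proof -
  interpret f: bounded_linear f by (rule f)
  obtain C where C: "\<And>x. \<bar>f x\<bar> \<le> norm x * C" "C \<ge> 0"
    using f.nonneg_bounded by (auto simp: real_norm_def)
  define J where "J x = (norm x)\<^sup>2 / 2 - f x" for x
  define m where "m = (INF x. J x)"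
  have bdd: "bdd_below (range J)"
  proof (rule bdd_belowI2)
    fix x :: 'a
    have "0 \<le> (norm x - C)\<^sup>2" by simp
    hence "norm x * C \<le> (norm x)\<^sup>2 / 2 + C\<^sup>2 / 2" by (simp add: power2_diff)
    with C(1)[of x] show "- (C\<^sup>2 / 2) \<le> J x" unfolding J_def by linarith
  qed
  have m_le: "m \<le> J x" for x unfolding m_def by (rule cINF_lower[OF bdd]) simp
  have "\<exists>x. J x < m + inverse (real (Suc n))" for n
  proof -
    have "Inf (range J) < m + inverse (real (Suc n))" by (simp add: m_def)
    thus ?thesis using cInf_lessD[of "range J"] by blast
  qed
  then obtain X where X: "\<And>n. J (X n) < m + inverse (real (Suc n))" by metis
  have par: "(norm (x - y))\<^sup>2 = 4 * (J x + J y - 2 * J ((1/2) *\<^sub>R (x + y)))" for x y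
    unfolding J_def power2_norm_eq_inner
    by (simp add: f.scaleR f.add inner_add inner_diff algebra_simps inner_commute)
  have close: "(norm (X i - X j))\<^sup>2 \<le> 4 * (inverse (real (Suc i)) + inverse (real (Suc j)))" for i j
  proof -
    have "J (X i) + J (X j) - 2 * J ((1/2) *\<^sub>R (X i + X j))
        \<le> (m + inverse (real (Suc i))) + (m + inverse (real (Suc j))) - 2 * m"
      by (intro diff_mono add_mono mult_left_mono m_le less_imp_le[OF X]) simp
    thus ?thesis unfolding par by simp
  qed
  have "Cauchy X"
  proof (rule metric_CauchyI)
    fix e :: real assume e: "e > 0"
    obtain N where N: "inverse (real (Suc N)) < e\<^sup>2 / 8"
      using reals_Archimedean[of "e\<^sup>2 / 8"] e by auto
    have "dist (X i) (X j) < e" if "i \<ge> N" "j \<ge> N" for i j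
    proof -
      have "inverse (real (Suc i)) \<le> inverse (real (Suc N))"
        "inverse (real (Suc j)) \<le> inverse (real (Suc N))"
        using that by (auto intro!: le_imp_inverse_le)
      hence "4 * (inverse (real (Suc i)) + inverse (real (Suc j)))
          \<le> 4 * (inverse (real (Suc N)) + inverse (real (Suc N)))"
        by (intro mult_left_mono add_mono) simp_all
      also have "\<dots> < e\<^sup>2" using N by simp
      finally have "(norm (X i - X j))\<^sup>2 < e\<^sup>2" using close[of i j] by (rule le_less_trans[rotated])
      thus ?thesis using e by (simp add: dist_norm power2_less_imp_less)
    qed
    thus "\<exists>M. \<forall>i\<ge>M. \<forall>j\<ge>M. dist (X i) (X j) < e" by blast
  qed
  then obtain y where y: "X \<longlonglongrightarrow> y" using Cauchy_convergent convergent_def by blast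
  have "(\<lambda>n. J (X n)) \<longlonglongrightarrow> J y" unfolding J_def
    by (intro tendsto_intros y f.tendsto) simp
  moreover have "(\<lambda>n. m + inverse (real (Suc n))) \<longlonglongrightarrow> m + 0"
    by (intro tendsto_intros LIMSEQ_inverse_real_of_nat)
  ultimately have "J y \<le> m + 0"
    using X by (intro LIMSEQ_le) (auto intro: less_imp_le)
  hence Jy: "J y \<le> J z" for z using m_le[of z] by simp
  have "f x = inner x y" for x
  proof (rule ccontr)
    define d where "d = inner x y - f x"
    assume "f x \<noteq> inner x y"
    hence d: "d \<noteq> 0" by (simp add: d_def)
    hence x: "x \<noteq> 0" by (auto simp: d_def f.zero)
    have J_line: "J (y + t *\<^sub>R x) = J y + t * d + t\<^sup>2 * (norm x)\<^sup>2 / 2" for t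
      unfolding J_def d_def power2_norm_eq_inner
      by (simp add: f.scaleR f.add inner_add algebra_simps inner_commute power2_eq_square)
    \<comment> \<open>The minimum of this quadratic polynomial in \<open>t\<close>.\<close>
    define t where "t = - d / (norm x)\<^sup>2"
    have "J (y + t *\<^sub>R x) = J y - d\<^sup>2 / (2 * (norm x)\<^sup>2)"
      using x unfolding J_line t_def by (simp add: field_simps power2_eq_square)
    moreover have "d\<^sup>2 / (2 * (norm x)\<^sup>2) > 0" using d x by simp
    ultimately show False using Jy[of "y + t *\<^sub>R x"] by linarith
  qed
  thus ?thesis by blast
qed

lemma bounded_opsD: "T \<in> bounded_ops \<Longrightarrow> T (c *\<^sub>C x) = c *\<^sub>C T x"
  by (simp add: bounded_ops_def)

lemma is_adjoint_sym: "is_adjoint T S \<Longrightarrow> is_adjoint S T"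
  unfolding is_adjoint_def
proof (intro allI)
  fix x y
  assume "\<forall>x y. cinner (T x) y = cinner x (S y)"
  hence "cnj (cinner (T y) x) = cnj (cinner y (S x))" by simp
  thus "cinner (S x) y = cinner x (T y)" by (simp only: cinner_commute[symmetric])
qed

lemma is_adjoint_unique:
  assumes "is_adjoint T S" "is_adjoint T S'"
  shows "S = S'"
proof (rule blinfun_eqI)
  fix y
  have *: "cinner z (S y) = cinner z (S' y)" for z
    using assms[unfolded is_adjoint_def, rule_format, of z y] by (rule trans[OF sym])
  show "S y = S' y"
    by (rule inner_extensionality) (simp add: inner_eq_Re_cinner *)
qed

text \<open>The Riesz theorem for the real inner product yields a real adjoint; the operator being complex
  linear, replacing \<open>x\<close> by \<open>\<i>x\<close> shows that the imaginary parts agree too.\<close>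

lemma adjoint_exists:
  fixes T :: "'h::chilbert_space \<Rightarrow>\<^sub>L 'h"
  assumes T: "T \<in> bounded_ops"
  obtains S where "S \<in> bounded_ops" "is_adjoint T S"
proof -
  have "\<exists>z. \<forall>x. inner (T x) y = inner x z" for y
    by (rule riesz_representation)
      (intro bounded_linear_compose[OF bounded_linear_inner_left] blinfun.bounded_linear_right)
  then obtain s where s: "\<And>x y. inner (T x) y = inner x (s y)" by metis
  have Re_eq: "Re (cinner (T x) y) = Re (cinner x (s y))" for x y
    using s by (simp add: inner_eq_Re_cinner)
  have adj: "cinner (T x) y = cinner x (s y)" for x y
  proof -
    have "Im (cinner (T x) y) = Im (cinner x (s y))"
      using Re_eq[of "\<i> *\<^sub>C x" y] by (simp add: bounded_opsD[OF T] cinner_scaleC_left)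
    with Re_eq show ?thesis by (simp add: complex_eq_iff)
  qed
  have s_add: "s (x + y) = s x + s y" for x y
    by (rule inner_extensionality) (simp add: inner_add_right s[symmetric])
  have s_scaleC: "s (c *\<^sub>C x) = c *\<^sub>C s x" for c x
    by (rule inner_extensionality)
      (simp add: inner_eq_Re_cinner cinner_scaleC_right adj[symmetric])
  have s_bound: "norm (s y) \<le> norm y * norm T" for y
  proof (cases "s y = 0")
    case False
    have "(norm (s y))\<^sup>2 = inner (T (s y)) y" by (simp add: s power2_norm_eq_inner)
    also have "\<dots> \<le> norm (T (s y)) * norm y" by (rule norm_cauchy_schwarz)
    also have "\<dots> \<le> (norm T * norm (s y)) * norm y"
      by (intro mult_right_mono norm_blinfun) simp
    finally show ?thesis using False by (simp add: power2_eq_square mult.commute)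
  qed simp
  have bl: "bounded_linear s"
    by (rule bounded_linear_intro[OF s_add _ s_bound]) (simp add: scaleR_scaleC s_scaleC)
  show thesis
  proof (rule that)
    show "Blinfun s \<in> bounded_ops"
      by (simp add: bounded_ops_def bounded_linear_Blinfun_apply[OF bl] s_scaleC)
    show "is_adjoint T (Blinfun s)"
      by (simp add: is_adjoint_def bounded_linear_Blinfun_apply[OF bl] adj)
  qed
qed

lemma is_adjoint_in_bounded_ops:
  assumes "T \<in> bounded_ops" "is_adjoint T S"
  shows "S \<in> bounded_ops"
proof -
  obtain S' where "S' \<in> bounded_ops" "is_adjoint T S'" using assms(1) by (rule adjoint_exists)
  with is_adjoint_unique[OF assms(2)] show ?thesis by simp
qed

lemma is_adjoint_plus: "is_adjoint T S \<Longrightarrow> is_adjoint T' S' \<Longrightarrow> is_adjoint (T + T') (S + S')"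
  by (simp add: is_adjoint_def blinfun.add_left cinner_add_left cinner_add_right)

lemma is_adjoint_diff: "is_adjoint T S \<Longrightarrow> is_adjoint T' S' \<Longrightarrow> is_adjoint (T - T') (S - S')"
  by (simp add: is_adjoint_def blinfun.diff_left cinner_diff_left cinner_diff_right)

lemma is_adjoint_compose:
  "is_adjoint T S \<Longrightarrow> is_adjoint T' S' \<Longrightarrow> is_adjoint (T o\<^sub>L T') (S' o\<^sub>L S)"
  by (simp add: is_adjoint_def)

lemma is_adjoint_scaleC: "is_adjoint T S \<Longrightarrow> is_adjoint (scaleC_op c T) (scaleC_op (cnj c) S)"
  by (simp add: is_adjoint_def scaleC_op.rep_eq cinner_scaleC_left cinner_scaleC_right)

lemma norm_adjoint_le:
  assumes "is_adjoint T S"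
  shows "norm S \<le> norm T"
proof (rule norm_blinfun_bound)
  fix y
  show "norm (S y) \<le> norm T * norm y"
  proof (cases "S y = 0")
    case False
    have "(norm (S y))\<^sup>2 = cmod (cinner (S y) (S y))" by (simp add: cinner_self del: of_real_power)
    also have "cinner (S y) (S y) = cinner (T (S y)) y"
      using assms by (simp add: is_adjoint_def)
    also have "cmod \<dots> \<le> norm (T (S y)) * norm y" by (rule cmod_cinner_le)
    also have "\<dots> \<le> (norm T * norm (S y)) * norm y"
      by (intro mult_right_mono norm_blinfun) simp
    finally show ?thesis using False by (simp add: power2_eq_square)
  qed simp
qed simp

lemma scaleC_tendsto:
  assumes "f \<longlonglongrightarrow> (l::'a::chilbert_space)"
  shows "(\<lambda>n. c *\<^sub>C f n) \<longlonglongrightarrow> c *\<^sub>C l"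
proof -
  have "bounded_linear (\<lambda>x::'a. c *\<^sub>C x)"
    by (rule bounded_linear_intro[where K = "cmod c"])
      (simp_all add: scaleC_add_right scaleR_scaleC scaleC_scaleC norm_scaleC mult.commute)
  thus ?thesis using assms by (rule bounded_linear.tendsto)
qed

lemma closed_bounded_ops: "closed (bounded_ops :: ('h::chilbert_space \<Rightarrow>\<^sub>L 'h) set)"
  unfolding closed_sequential_limits
proof safe
  fix F and T :: "'h \<Rightarrow>\<^sub>L 'h"
  assume F: "\<forall>n. F n \<in> bounded_ops" and lim: "F \<longlonglongrightarrow> T"
  have pt: "(\<lambda>n. F n z) \<longlonglongrightarrow> T z" for z
    using lim by (intro blinfun.tendsto tendsto_const)
  have "T (c *\<^sub>C x) = c *\<^sub>C T x" for c x
  proof (rule LIMSEQ_unique[OF pt])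
    show "(\<lambda>n. F n (c *\<^sub>C x)) \<longlonglongrightarrow> c *\<^sub>C T x"
      using F scaleC_tendsto[OF pt] by (simp add: bounded_opsD)
  qed
  thus "T \<in> bounded_ops" by (simp add: bounded_ops_def)
qed

lemma scaleC_zero: "c *\<^sub>C (0::'a::chilbert_space) = 0"
  using norm_scaleC[of c "0::'a"] by simp

lemma subalgebra_bounded_ops: "subalgebra (bounded_ops :: ('a::chilbert_space \<Rightarrow>\<^sub>L 'a) set)"
proof -
  have "scaleC_op d a \<in> bounded_ops" if "a \<in> bounded_ops" for d and a :: "'a \<Rightarrow>\<^sub>L 'a"
    using that by (auto simp: bounded_ops_def scaleC_op.rep_eq scaleC_scaleC mult.commute)
  moreover have "a + b \<in> bounded_ops \<and> a o\<^sub>L b \<in> bounded_ops"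
    if "a \<in> bounded_ops" "b \<in> bounded_ops" for a b :: "'a \<Rightarrow>\<^sub>L 'a"
    using that by (auto simp: bounded_ops_def blinfun.add_left scaleC_add_right)
  moreover have "(0 :: 'a \<Rightarrow>\<^sub>L 'a) \<in> bounded_ops"
    by (auto simp: bounded_ops_def scaleC_zero)
  ultimately show ?thesis unfolding subalgebra_def by blast
qed

text \<open>Adjoints exist and are unique on \<open>bounded_ops\<close>, so the quantifier over adjoints ranges over
  exactly one operator.\<close>

definition reducing_ops :: "'h::chilbert_space set \<Rightarrow> ('h \<Rightarrow>\<^sub>L 'h) set" where
  "reducing_ops M = {T \<in> bounded_ops. (\<forall>x\<in>M. T x \<in> M) \<and>
     (\<forall>S. is_adjoint T S \<longrightarrow> (\<forall>x\<in>M. S x \<in> M))}"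

lemma reducing_opsI:
  assumes "T \<in> bounded_ops" "is_adjoint T S"
    and "\<And>x. x \<in> M \<Longrightarrow> T x \<in> M" "\<And>x. x \<in> M \<Longrightarrow> S x \<in> M"
  shows "T \<in> reducing_ops M"
proof -
  have "S' x \<in> M" if "is_adjoint T S'" "x \<in> M" for S' x
    using assms(4)[OF that(2)] is_adjoint_unique[OF assms(2) that(1)] by simp
  thus ?thesis using assms(1,3) by (simp add: reducing_ops_def)
qed

lemma reducing_opsE:
  assumes "T \<in> reducing_ops M"
  obtains S where "T \<in> bounded_ops" "is_adjoint T S"
    "\<forall>x\<in>M. T x \<in> M" "\<forall>x\<in>M. S x \<in> M"
proof -
  from assms have T: "T \<in> bounded_ops" by (simp add: reducing_ops_def)
  then obtain S where "is_adjoint T S" by (rule adjoint_exists)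
  with T assms show thesis by (intro that[of S]) (auto simp: reducing_ops_def)
qed

text \<open>The reason for considering reducing instead of invariant subspaces: a closed subspace that reduces
  every operator in a set reduces the generated C*-algebra. Norm limits are harmless since taking
  adjoints is isometric.\<close>

lemma cstar_subalgebra_reducing_ops:
  fixes M :: "'h::chilbert_space set"
  assumes zero: "0 \<in> M"
    and add: "\<And>x y. x \<in> M \<Longrightarrow> y \<in> M \<Longrightarrow> x + y \<in> M"
    and scale: "\<And>c x. x \<in> M \<Longrightarrow> c *\<^sub>C x \<in> M"
    and cl: "closed M"
  shows "cstar_subalgebra (reducing_ops M)"
  unfolding cstar_subalgebra_def
proof (intro conjI)
  have alg: "0 \<in> (bounded_ops :: ('h \<Rightarrow>\<^sub>L 'h) set)"
    "\<And>a b :: 'h \<Rightarrow>\<^sub>L 'h. a \<in> bounded_ops \<Longrightarrow> b \<in> bounded_ops \<Longrightarrow> a + b \<in> bounded_ops"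
    "\<And>a b :: 'h \<Rightarrow>\<^sub>L 'h. a \<in> bounded_ops \<Longrightarrow> b \<in> bounded_ops \<Longrightarrow> a o\<^sub>L b \<in> bounded_ops"
    "\<And>c (a :: 'h \<Rightarrow>\<^sub>L 'h). a \<in> bounded_ops \<Longrightarrow> scaleC_op c a \<in> bounded_ops"
    using subalgebra_bounded_ops[where 'a = 'h] by (auto simp: subalgebra_def)
  show "subalgebra (reducing_ops M)"
    unfolding subalgebra_def
  proof (intro conjI ballI allI)
    show "reducing_ops M \<subseteq> bounded_ops" by (auto simp: reducing_ops_def)
    have "is_adjoint (0 :: 'h \<Rightarrow>\<^sub>L 'h) 0"
      by (simp add: is_adjoint_def cinner_zero_left cinner_zero_right)
    thus "0 \<in> reducing_ops M"
      by (rule reducing_opsI[OF alg(1)]) (simp_all add: zero)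
  next
    fix a b assume ab: "a \<in> reducing_ops M" "b \<in> reducing_ops M"
    obtain a' where a: "a \<in> bounded_ops" "is_adjoint a a'"
        "\<forall>x\<in>M. a x \<in> M" "\<forall>x\<in>M. a' x \<in> M"
      using ab(1) by (rule reducing_opsE)
    obtain b' where b: "b \<in> bounded_ops" "is_adjoint b b'"
        "\<forall>x\<in>M. b x \<in> M" "\<forall>x\<in>M. b' x \<in> M"
      using ab(2) by (rule reducing_opsE)
    show "a + b \<in> reducing_ops M"
      by (rule reducing_opsI[OF alg(2)[OF a(1) b(1)] is_adjoint_plus[OF a(2) b(2)]])
        (simp_all add: blinfun.add_left add a b)
    show "a o\<^sub>L b \<in> reducing_ops M"
      by (rule reducing_opsI[OF alg(3)[OF a(1) b(1)] is_adjoint_compose[OF a(2) b(2)]])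
        (simp_all add: a b)
  next
    fix c a assume "a \<in> reducing_ops M"
    then obtain a' where a: "a \<in> bounded_ops" "is_adjoint a a'"
        "\<forall>x\<in>M. a x \<in> M" "\<forall>x\<in>M. a' x \<in> M"
      by (rule reducing_opsE)
    show "scaleC_op c a \<in> reducing_ops M"
      by (rule reducing_opsI[OF alg(4)[OF a(1)] is_adjoint_scaleC[OF a(2)]])
        (simp_all add: scaleC_op.rep_eq scale a)
  qed
  show "self_adjoint_set (reducing_ops M)"
    unfolding self_adjoint_set_def
  proof
    fix a assume "a \<in> reducing_ops M"
    then obtain a' where a: "a \<in> bounded_ops" "is_adjoint a a'"
        "\<forall>x\<in>M. a x \<in> M" "\<forall>x\<in>M. a' x \<in> M"
      by (rule reducing_opsE)
    have "a' \<in> reducing_ops M"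
      by (rule reducing_opsI[OF is_adjoint_in_bounded_ops[OF a(1,2)] is_adjoint_sym[OF a(2)]])
        (simp_all add: a)
    thus "\<exists>S\<in>reducing_ops M. is_adjoint a S" using a(2) by blast
  qed
  show "closed (reducing_ops M)"
    unfolding closed_sequential_limits
  proof safe
    fix F and T :: "'h \<Rightarrow>\<^sub>L 'h"
    assume F: "\<forall>n. F n \<in> reducing_ops M" and lim: "F \<longlonglongrightarrow> T"
    have T: "T \<in> bounded_ops"
      using closed_bounded_ops F lim unfolding closed_sequential_limits reducing_ops_def by blast
    then obtain S where S: "is_adjoint T S" by (rule adjoint_exists)
    have "\<exists>G. is_adjoint (F n) G \<and> (\<forall>x\<in>M. G x \<in> M)" for n
    proof -
      from F have "F n \<in> reducing_ops M" by blast
      then obtain G where "is_adjoint (F n) G" "\<forall>x\<in>M. G x \<in> M" by (rule reducing_opsE)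
      thus ?thesis by blast
    qed
    then obtain G where G: "\<And>n. is_adjoint (F n) (G n)" "\<And>n x. x \<in> M \<Longrightarrow> G n x \<in> M"
      by metis
    have limG: "G \<longlonglongrightarrow> S"
    proof (rule LIM_zero_cancel, rule Lim_null_comparison)
      show "\<forall>\<^sub>F n in sequentially. norm (G n - S) \<le> norm (F n - T)"
        by (intro always_eventually allI norm_adjoint_le is_adjoint_diff G S)
      show "(\<lambda>n. norm (F n - T)) \<longlonglongrightarrow> 0" using lim by (intro tendsto_norm_zero LIM_zero)
    qed
    show "T \<in> reducing_ops M"
    proof (rule reducing_opsI[OF T S])
      fix x assume x: "x \<in> M"
      have Fx: "F n x \<in> M" for n using F x by (auto simp: reducing_ops_def)
      show "T x \<in> M"
        by (rule closed_sequentially[of M "\<lambda>n. F n x", OF cl Fx]) (intro blinfun.tendsto tendsto_const lim)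
      show "S x \<in> M"
        by (rule closed_sequentially[of M "\<lambda>n. G n x", OF cl G(2)[OF x]]) (intro blinfun.tendsto tendsto_const limG)
    qed
  qed
qed

section \<open>Absolutely continuous functionals form a bimodule\<close>

lemma square_summable_image:
  assumes "square_summable x"
  shows "square_summable (\<lambda>n. blinfun_apply T (x n))"
proof -
  have "summable (\<lambda>n. (norm T)\<^sup>2 * (norm (x n))\<^sup>2)"
    using assms by (intro summable_mult) (simp add: square_summable_def)
  thus ?thesis unfolding square_summable_def
  proof (rule summable_comparison_test')
    fix n
    show "norm ((norm (T (x n)))\<^sup>2) \<le> (norm T)\<^sup>2 * (norm (x n))\<^sup>2"
      by (simp add: power_mult_distrib[symmetric] power_mono norm_blinfun)
  qed
qed

text \<open>A map is weak-* continuous once it pulls the functionals that generate the topology back to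
  functionals of the same kind.\<close>

lemma weak_star_continuous_self_map:
  fixes W :: "('k::chilbert_space \<Rightarrow>\<^sub>L 'k) set"
  assumes "W \<subseteq> bounded_ops"
    and "\<And>T. T \<in> bounded_ops \<Longrightarrow> f T \<in> bounded_ops" "\<And>T. T \<in> W \<Longrightarrow> f T \<in> W"
    and predual: "\<And>x y. square_summable x \<Longrightarrow> square_summable y \<Longrightarrow>
      \<exists>x' y'. square_summable x' \<and> square_summable y' \<and>
        (\<forall>T. predual_functional x y (f T) = predual_functional x' y' T)"
  shows "continuous_map (weak_star_topology W) (weak_star_topology W) f"
proof -
  let ?S = "{{T \<in> bounded_ops. predual_functional x y T \<in> U} | x y U.
        square_summable x \<and> square_summable y \<and> open U} :: ('k \<Rightarrow>\<^sub>L 'k) set set"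
  \<comment> \<open>The zero sequences and the full target set contribute all of \<open>bounded_ops\<close>.\<close>
  have U: "\<Union> ?S = bounded_ops"
  proof -
    have "square_summable (\<lambda>_. 0 :: 'k)" by (simp add: square_summable_def)
    hence "{T \<in> bounded_ops. predual_functional (\<lambda>_. 0::'k) (\<lambda>_. 0::'k) T \<in> UNIV} \<in> ?S"
      by blast
    thus ?thesis by auto
  qed
  have "continuous_map ultraweak_topology ultraweak_topology f"
    unfolding ultraweak_topology_def
  proof (rule continuous_on_generated_topo)
    fix V assume "V \<in> ?S"
    then obtain x y O' where V: "V = {T \<in> bounded_ops. predual_functional x y T \<in> O'}"
      and xy: "square_summable x" "square_summable y" and "open O'" by blast
    obtain x' y' where "square_summable x'" "square_summable y'"
      and eq: "\<And>T. predual_functional x y (f T) = predual_functional x' y' T"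
      using predual[OF xy] by blast
    have "f -` V \<inter> topspace (topology_generated_by ?S) =
        {T \<in> bounded_ops. predual_functional x' y' T \<in> O'}" (is "_ = ?V'")
      unfolding topology_generated_by_topspace U using assms(2) by (auto simp: V eq)
    moreover have "?V' \<in> ?S"
      using \<open>square_summable x'\<close> \<open>square_summable y'\<close> \<open>open O'\<close> by blast
    hence "openin (topology_generated_by ?S) ?V'" by (rule topology_generated_by_Basis)
    ultimately show "openin (topology_generated_by ?S)
        (f -` V \<inter> topspace (topology_generated_by ?S))"
      by (simp only:)
  next
    show "f ` topspace (topology_generated_by ?S) \<subseteq> \<Union> ?S"
      unfolding topology_generated_by_topspace U using assms(2) by blast
  qed
  thus ?thesis unfolding weak_star_topology_def
    using assms(3) by (auto simp: continuous_map_in_subtopology continuous_map_from_subtopology)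
qed

lemma abs_continuous_functional_comp:
  assumes AW: "A \<subseteq> W"
    and \<phi>: "abs_continuous_functional W A \<phi>"
    and fW: "\<And>T. T \<in> W \<Longrightarrow> f T \<in> W" and fA: "\<And>T. T \<in> A \<Longrightarrow> f T \<in> A"
    and lin: "\<And>S T. f (S + T) = f S + f T"
      "\<And>c T. T \<in> W \<Longrightarrow> f (scaleC_op c T) = scaleC_op c (f T)"
    and bound: "\<And>T. norm (f T) \<le> K * norm T"
    and cont: "continuous_map (weak_star_topology W) (weak_star_topology W) f"
  shows "abs_continuous_functional W A (\<lambda>a. \<phi> (f a))"
proof -
  obtain \<omega> where \<omega>: "linear_functional_on W \<omega>"
      "continuous_map (weak_star_topology W) euclidean \<omega>" "\<And>a. a \<in> A \<Longrightarrow> \<omega> a = \<phi> a"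
    and b: "bounded_functional_on A \<phi>"
    using \<phi> unfolding abs_continuous_functional_def by blast
  obtain C where C: "\<And>a. a \<in> A \<Longrightarrow> cmod (\<phi> a) \<le> C * norm a"
    and \<phi>_lin: "linear_functional_on A \<phi>"
    using b unfolding bounded_functional_on_def by blast
  have "cmod (\<phi> (f a)) \<le> (\<bar>C\<bar> * K) * norm a" if "a \<in> A" for a
  proof -
    have "cmod (\<phi> (f a)) \<le> C * norm (f a)" using C fA that by blast
    also have "\<dots> \<le> \<bar>C\<bar> * norm (f a)" by (intro mult_right_mono) auto
    also have "\<dots> \<le> \<bar>C\<bar> * (K * norm a)" by (intro mult_left_mono bound) auto
    finally show ?thesis by (simp add: mult.assoc)
  qed
  moreover have "linear_functional_on A (\<lambda>a. \<phi> (f a))"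
    using \<phi>_lin fA lin AW unfolding linear_functional_on_def by (metis subsetD)
  moreover have "linear_functional_on W (\<lambda>a. \<omega> (f a))"
    using \<omega>(1) fW lin unfolding linear_functional_on_def by metis
  moreover have "continuous_map (weak_star_topology W) euclidean (\<lambda>a. \<omega> (f a))"
    using continuous_map_compose[OF cont \<omega>(2)] by (simp add: o_def)
  moreover have "\<forall>a\<in>A. \<omega> (f a) = \<phi> (f a)" using \<omega>(3) fA by blast
  ultimately show ?thesis
    unfolding abs_continuous_functional_def bounded_functional_on_def by blast
qed

text \<open>Right multiplication acts on a functional given by sequences \<open>x\<close> and \<open>y\<close> by replacing \<open>x\<^sub>n\<close> with
  \<open>a x\<^sub>n\<close>; left multiplication replaces \<open>y\<^sub>n\<close> with \<open>a* y\<^sub>n\<close>.\<close>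

lemma abs_continuous_functional_mult_right:
  assumes W: "subalgebra W" and A: "subalgebra A" and AW: "A \<subseteq> W"
    and \<phi>: "abs_continuous_functional W A \<phi>" and a: "a \<in> A"
  shows "abs_continuous_functional W A (\<lambda>b. \<phi> (b o\<^sub>L a))"
proof (rule abs_continuous_functional_comp[OF AW \<phi>])
  have bW: "W \<subseteq> bounded_ops" "a \<in> W" using W AW a by (auto simp: subalgebra_def)
  show "T o\<^sub>L a \<in> W" if "T \<in> W" for T using W that bW by (auto simp: subalgebra_def)
  show "T o\<^sub>L a \<in> A" if "T \<in> A" for T using A that a by (auto simp: subalgebra_def)
  show "(S + T) o\<^sub>L a = (S o\<^sub>L a) + (T o\<^sub>L a)" for S T
    by (rule blinfun_eqI) (simp add: blinfun.add_left)
  show "scaleC_op c T o\<^sub>L a = scaleC_op c (T o\<^sub>L a)" for c T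
    by (rule blinfun_eqI) (simp add: scaleC_op.rep_eq)
  show "norm (T o\<^sub>L a) \<le> norm a * norm T" for T
    using norm_blinfun_compose[of T a] by (simp add: mult.commute)
  show "continuous_map (weak_star_topology W) (weak_star_topology W) (\<lambda>T. T o\<^sub>L a)"
  proof (rule weak_star_continuous_self_map[OF bW(1)])
    show "T o\<^sub>L a \<in> bounded_ops" if "T \<in> bounded_ops" for T
      using subalgebra_bounded_ops that bW unfolding subalgebra_def by blast
    show "T o\<^sub>L a \<in> W" if "T \<in> W" for T using W that bW by (auto simp: subalgebra_def)
  next
    fix x y :: "nat \<Rightarrow> 'a" assume "square_summable x" "square_summable y"
    thus "\<exists>x' y'. square_summable x' \<and> square_summable y' \<and>
        (\<forall>T. predual_functional x y (T o\<^sub>L a) = predual_functional x' y' T)"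
      by (intro exI[of _ "\<lambda>n. a (x n)"] exI[of _ y])
        (simp add: square_summable_image predual_functional_def)
  qed
qed

lemma abs_continuous_functional_mult_left:
  assumes W: "subalgebra W" and A: "subalgebra A" and AW: "A \<subseteq> W"
    and \<phi>: "abs_continuous_functional W A \<phi>" and a: "a \<in> A"
  shows "abs_continuous_functional W A (\<lambda>b. \<phi> (a o\<^sub>L b))"
proof (rule abs_continuous_functional_comp[OF AW \<phi>])
  have bW: "W \<subseteq> bounded_ops" "a \<in> W" using W AW a by (auto simp: subalgebra_def)
  hence ab: "a \<in> bounded_ops" by blast
  show "a o\<^sub>L T \<in> W" if "T \<in> W" for T using W that bW by (auto simp: subalgebra_def)
  show "a o\<^sub>L T \<in> A" if "T \<in> A" for T using A that a by (auto simp: subalgebra_def)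
  show "a o\<^sub>L (S + T) = (a o\<^sub>L S) + (a o\<^sub>L T)" for S T
    by (rule blinfun_eqI) (simp add: blinfun.add_left blinfun.add_right)
  show "a o\<^sub>L scaleC_op c T = scaleC_op c (a o\<^sub>L T)" for c T
    by (rule blinfun_eqI) (simp add: scaleC_op.rep_eq bounded_opsD[OF ab])
  show "norm (a o\<^sub>L T) \<le> norm a * norm T" for T by (rule norm_blinfun_compose)
  show "continuous_map (weak_star_topology W) (weak_star_topology W) (\<lambda>T. a o\<^sub>L T)"
  proof (rule weak_star_continuous_self_map[OF bW(1)])
    show "a o\<^sub>L T \<in> bounded_ops" if "T \<in> bounded_ops" for T
      using subalgebra_bounded_ops that ab unfolding subalgebra_def by blast
    show "a o\<^sub>L T \<in> W" if "T \<in> W" for T using W that bW by (auto simp: subalgebra_def)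
  next
    fix x y :: "nat \<Rightarrow> 'a" assume "square_summable x" "square_summable y"
    moreover obtain a' where "is_adjoint a a'" using adjoint_exists[OF ab] by blast
    ultimately show "\<exists>x' y'. square_summable x' \<and> square_summable y' \<and>
        (\<forall>T. predual_functional x y (a o\<^sub>L T) = predual_functional x' y' T)"
      by (intro exI[of _ x] exI[of _ "\<lambda>n. a' (y n)"])
        (simp add: square_summable_image predual_functional_def is_adjoint_def)
  qed
qed


section \<open>Dominated sesquilinear forms\<close>

definition sesquilinear :: "('h::chilbert_space \<Rightarrow> 'h \<Rightarrow> complex) \<Rightarrow> bool" where
  "sesquilinear b \<longleftrightarrow> (\<forall>x y z. b (x + y) z = b x z + b y z) \<and>
     (\<forall>x y z. b x (y + z) = b x y + b x z) \<and>
     (\<forall>c x y. b (c *\<^sub>C x) y = c * b x y) \<and> (\<forall>c x y. b x (c *\<^sub>C y) = cnj c * b x y)"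

lemma sesquilinear_flip: "sesquilinear b \<Longrightarrow> sesquilinear (\<lambda>x y. cnj (b y x))"
  by (simp add: sesquilinear_def)

lemma sesquilinear_polarization:
  assumes "sesquilinear b"
  shows "4 * b x y = b (x + 1 *\<^sub>C y) (x + 1 *\<^sub>C y) - b (x + (-1) *\<^sub>C y) (x + (-1) *\<^sub>C y)
    + \<i> * b (x + \<i> *\<^sub>C y) (x + \<i> *\<^sub>C y) - \<i> * b (x + (-\<i>) *\<^sub>C y) (x + (-\<i>) *\<^sub>C y)"
  using assms unfolding sesquilinear_def by (simp add: algebra_simps)

lemma sesquilinear_parallelogram:
  assumes "sesquilinear b"
  shows "b (x + 1 *\<^sub>C y) (x + 1 *\<^sub>C y) + b (x + (-1) *\<^sub>C y) (x + (-1) *\<^sub>C y)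
    + b (x + \<i> *\<^sub>C y) (x + \<i> *\<^sub>C y) + b (x + (-\<i>) *\<^sub>C y) (x + (-\<i>) *\<^sub>C y)
    = 4 * (b x x + b y y)"
  using assms unfolding sesquilinear_def by (simp add: algebra_simps)

text \<open>Polarizing \<open>b\<close> and then applying the parallelogram law to \<open>g\<close> turns the bound on the diagonal into
  \<open>\<bar>b(u, y)\<bar> \<le> C (g(u, u) + g(y, y))\<close>. For \<open>u = t x\<close> with \<open>g(x, x) = 0\<close> the right-hand side does not depend
  on \<open>t\<close>, while the left-hand side is \<open>\<bar>t\<bar> \<bar>b(x, y)\<bar>\<close>.\<close>

lemma dominated_sesquilinear_left_null:
  assumes b: "sesquilinear b" and g: "sesquilinear g"
    and dom: "\<And>z. cmod (b z z) \<le> C * Re (g z z)" and null: "g x x = 0"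
  shows "b x y = 0"
proof (rule ccontr)
  assume nz: "b x y \<noteq> 0"
  have bound: "cmod (b u y) \<le> C * Re (g u u + g y y)" for u
  proof -
    let ?u = "\<lambda>c. u + c *\<^sub>C y"
    have "4 * cmod (b u y) = cmod (4 * b u y)" by (simp add: norm_mult)
    also have "\<dots> \<le> cmod (b (?u 1) (?u 1)) + cmod (b (?u (-1)) (?u (-1)))
        + cmod (\<i> * b (?u \<i>) (?u \<i>)) + cmod (\<i> * b (?u (-\<i>)) (?u (-\<i>)))"
      unfolding sesquilinear_polarization[OF b]
      by (intro order_trans[OF norm_triangle_ineq4] order_trans[OF norm_triangle_ineq]
          add_right_mono order_refl)
    also have "\<dots> = cmod (b (?u 1) (?u 1)) + cmod (b (?u (-1)) (?u (-1)))
        + cmod (b (?u \<i>) (?u \<i>)) + cmod (b (?u (-\<i>)) (?u (-\<i>)))"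
      by (simp add: norm_mult)
    also have "\<dots> \<le> C * Re (g (?u 1) (?u 1)) + C * Re (g (?u (-1)) (?u (-1)))
        + C * Re (g (?u \<i>) (?u \<i>)) + C * Re (g (?u (-\<i>)) (?u (-\<i>)))"
      by (intro add_mono dom)
    also have "\<dots> = C * Re (g (?u 1) (?u 1) + g (?u (-1)) (?u (-1))
        + g (?u \<i>) (?u \<i>) + g (?u (-\<i>)) (?u (-\<i>)))"
      by (simp add: distrib_left)
    also have "\<dots> = 4 * (C * Re (g u u + g y y))"
      unfolding sesquilinear_parallelogram[OF g] by simp
    finally show ?thesis by simp
  qed
  \<comment> \<open>Chosen such that \<open>t \<bar>b(x, y)\<bar>\<close> exceeds the bound by one.\<close>
  define t where "t = (C * Re (g y y) + 1) / cmod (b x y)"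
  have "C * Re (g y y) \<ge> 0" using dom[of y] norm_ge_zero order_trans by blast
  hence t: "t \<ge> 0" by (simp add: t_def)
  have "cmod (b (of_real t *\<^sub>C x) y) = t * cmod (b x y)"
    using b t by (simp add: sesquilinear_def norm_mult)
  also have "\<dots> = C * Re (g y y) + 1" using nz by (simp add: t_def)
  finally show False
    using bound[of "of_real t *\<^sub>C x"] g null by (simp add: sesquilinear_def)
qed

lemma dominated_sesquilinear_right_null:
  assumes "sesquilinear b" "sesquilinear g"
    and "\<And>z. cmod (b z z) \<le> C * Re (g z z)" "g x x = 0"
  shows "b y x = 0"
  using dominated_sesquilinear_left_null[OF sesquilinear_flip[OF assms(1)] assms(2) _ assms(4), of C y]
    assms(3) by simp

section \<open>Dual norms\<close>

lemma bdd_above_dual_norm: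
  assumes "\<phi> \<in> dual_space A"
  shows "bdd_above ((\<lambda>a. cmod (\<phi> a)) ` {a \<in> A. norm a \<le> 1})"
proof -
  obtain K where K: "\<And>a. a \<in> A \<Longrightarrow> cmod (\<phi> a) \<le> K * norm a"
    using assms by (auto simp: dual_space_def bounded_functional_on_def)
  show ?thesis
  proof (rule bdd_aboveI2)
    fix a assume "a \<in> {a \<in> A. norm a \<le> 1}"
    hence a: "a \<in> A" "norm a \<le> 1" by auto
    have "K * norm a \<le> \<bar>K\<bar> * 1" using a(2) by (intro mult_mono) auto
    thus "cmod (\<phi> a) \<le> \<bar>K\<bar>" using K[OF a(1)] by simp
  qed
qed

lemma cmod_le_dual_norm:
  assumes A: "subalgebra A" and \<phi>: "\<phi> \<in> dual_space A" and a: "a \<in> A"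
  shows "cmod (\<phi> a) \<le> dual_norm A \<phi> * norm a"
proof (cases "norm a = 0")
  case True
  then show ?thesis
    using \<phi> a by (auto simp: dual_space_def bounded_functional_on_def)
next
  case False
  define b where "b = scaleC_op (of_real (1 / norm a)) a"
  have b_eq: "b = (1 / norm a) *\<^sub>R a"
    unfolding b_def
    by (rule blinfun_eqI) (simp add: scaleC_op.rep_eq blinfun.scaleR_left scaleR_scaleC)
  have b: "b \<in> A" "norm b \<le> 1"
    using A a False by (simp add: b_def subalgebra_def) (simp add: b_eq)
  have "cmod (\<phi> a) / norm a = cmod (\<phi> b)"
    using \<phi> a unfolding b_def
    by (simp add: dual_space_def bounded_functional_on_def linear_functional_on_def
        norm_mult norm_divide)
  also have "\<dots> \<le> dual_norm A \<phi>"
    unfolding dual_norm_def using b by (intro cSUP_upper bdd_above_dual_norm[OF \<phi>]) auto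
  finally show ?thesis using False by (simp add: divide_le_eq)
qed

lemma dual_norm_nonneg:
  assumes A: "subalgebra A" and \<phi>: "\<phi> \<in> dual_space A"
  shows "0 \<le> dual_norm A \<phi>"
proof -
  have "0 \<in> {a \<in> A. norm a \<le> 1}" using A by (simp add: subalgebra_def)
  hence "cmod (\<phi> 0) \<le> dual_norm A \<phi>"
    unfolding dual_norm_def by (intro cSUP_upper bdd_above_dual_norm[OF \<phi>])
  thus ?thesis using norm_ge_zero order_trans by blast
qed

lemma dual_norm_le:
  assumes A: "subalgebra A" and "0 \<le> C" and le: "\<And>a. a \<in> A \<Longrightarrow> cmod (\<phi> a) \<le> C * norm a"
  shows "dual_norm A \<phi> \<le> C"
  unfolding dual_norm_def
proof (rule cSUP_least)
  have "0 \<in> {a \<in> A. norm a \<le> 1}" using A by (simp add: subalgebra_def)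
  thus "{a \<in> A. norm a \<le> 1} \<noteq> {}" by blast
next
  fix a assume "a \<in> {a \<in> A. norm a \<le> 1}"
  hence "a \<in> A" "C * norm a \<le> C" using \<open>0 \<le> C\<close> by (auto intro: mult_left_le)
  thus "cmod (\<phi> a) \<le> C" using le order_trans by blast
qed

lemma dual_space_diff:
  assumes "\<phi> \<in> dual_space A" "\<psi> \<in> dual_space A"
  shows "(\<lambda>a. \<phi> a - \<psi> a) \<in> dual_space A"
proof -
  obtain K K' where K: "\<forall>a\<in>A. cmod (\<phi> a) \<le> K * norm a" "\<forall>a\<in>A. cmod (\<psi> a) \<le> K' * norm a"
    using assms unfolding dual_space_def bounded_functional_on_def by blast
  have "\<forall>a\<in>A. cmod (\<phi> a - \<psi> a) \<le> (K + K') * norm a"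
    using K by (auto simp: distrib_right intro!: order_trans[OF norm_triangle_ineq4] add_mono)
  moreover have "linear_functional_on A (\<lambda>a. \<phi> a - \<psi> a)"
    using assms unfolding dual_space_def bounded_functional_on_def linear_functional_on_def
    by (simp add: algebra_simps)
  ultimately show ?thesis
    using assms unfolding dual_space_def bounded_functional_on_def by auto
qed

lemma abs_continuous_functional_cong:
  assumes A: "subalgebra A" and eq: "\<And>a. a \<in> A \<Longrightarrow> \<phi> a = \<phi>' a"
    and \<phi>: "abs_continuous_functional W A \<phi>"
  shows "abs_continuous_functional W A \<phi>'"
proof -
  have mem: "\<And>a b. a \<in> A \<Longrightarrow> b \<in> A \<Longrightarrow> a + b \<in> A" "\<And>c a. a \<in> A \<Longrightarrow> scaleC_op c a \<in> A"
    using A by (auto simp: subalgebra_def)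
  have "bounded_functional_on A \<phi>'"
    using \<phi> mem unfolding abs_continuous_functional_def bounded_functional_on_def
      linear_functional_on_def by (simp add: eq)
  thus ?thesis using \<phi> eq unfolding abs_continuous_functional_def by auto
qed

section \<open>The subspace of absolutely continuous vectors\<close>

locale lebesgue_decomposed_rep =
  fixes W A :: "('k::chilbert_space \<Rightarrow>\<^sub>L 'k) set"
    and L :: "(('k \<Rightarrow>\<^sub>L 'k) \<Rightarrow> complex) \<Rightarrow> (('k \<Rightarrow>\<^sub>L 'k) \<Rightarrow> complex)"
    and \<pi> :: "('k \<Rightarrow>\<^sub>L 'k) \<Rightarrow> ('h::chilbert_space \<Rightarrow>\<^sub>L 'h)"
  assumes W: "subalgebra W" and A: "subalgebra A" and one: "id_blinfun \<in> A" and AW: "A \<subseteq> W"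
    and hom: "unital_homomorphism A \<pi>" and contr: "contractive_on A \<pi>"
    and L_map: "bounded_linear_map_on_dual A L"
    and L_idem: "\<And>\<phi>. \<phi> \<in> dual_space A \<Longrightarrow> L (L \<phi>) = L \<phi>"
    and L_range: "L ` dual_space A = AC_space W A"
    and L_norm: "\<And>\<phi>. \<phi> \<in> dual_space A \<Longrightarrow>
      dual_norm A \<phi> = dual_norm A (L \<phi>) + dual_norm A (\<lambda>a. \<phi> a - L \<phi> a)"
begin

text \<open>The value \<open>0\<close> outside \<open>A\<close> makes this an element of \<open>dual_space A\<close>.\<close>

definition coeff :: "'h \<Rightarrow> 'h \<Rightarrow> ('k \<Rightarrow>\<^sub>L 'k) \<Rightarrow> complex" where
  "coeff x y a = (if a \<in> A then cinner (\<pi> a x) y else 0)"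

definition sing :: "'h \<Rightarrow> 'h \<Rightarrow> ('k \<Rightarrow>\<^sub>L 'k) \<Rightarrow> complex" where
  "sing x y = (\<lambda>a. coeff x y a - L (coeff x y) a)"

text \<open>Absolute continuity of \<open>coeff x x\<close> alone is an equivalent condition, by \<open>ac_vectorsI\<close> and
  \<open>ac_vectorsD\<close>, but a quadratic one; this form makes it evident that a closed subspace results.\<close>

definition ac_vectors :: "'h set" where
  "ac_vectors = {x. \<forall>y a. sing x y a = 0 \<and> sing y x a = 0}"

lemma A_closed:
  "a \<in> A \<Longrightarrow> b \<in> A \<Longrightarrow> a + b \<in> A" "a \<in> A \<Longrightarrow> b \<in> A \<Longrightarrow> a o\<^sub>L b \<in> A"
  "a \<in> A \<Longrightarrow> scaleC_op c a \<in> A"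
  using A by (auto simp: subalgebra_def)

lemma \<pi>_rules:
  "a \<in> A \<Longrightarrow> \<pi> a \<in> bounded_ops" "\<pi> id_blinfun = id_blinfun"
  "a \<in> A \<Longrightarrow> b \<in> A \<Longrightarrow> \<pi> (a + b) = \<pi> a + \<pi> b"
  "a \<in> A \<Longrightarrow> b \<in> A \<Longrightarrow> \<pi> (a o\<^sub>L b) = \<pi> a o\<^sub>L \<pi> b"
  "a \<in> A \<Longrightarrow> \<pi> (scaleC_op c a) = scaleC_op c (\<pi> a)"
  using hom by (auto simp: unital_homomorphism_def)

lemma cmod_coeff_le: "a \<in> A \<Longrightarrow> cmod (coeff x y a) \<le> norm x * norm y * norm a"
proof -
  assume a: "a \<in> A"
  have "cmod (coeff x y a) \<le> norm (\<pi> a x) * norm y"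
    using cmod_cinner_le by (simp add: coeff_def a)
  also have "\<dots> \<le> (norm (\<pi> a) * norm x) * norm y"
    by (intro mult_right_mono norm_blinfun) simp
  also have "\<dots> \<le> (norm a * norm x) * norm y"
    using contr a by (intro mult_right_mono) (auto simp: contractive_on_def)
  finally show ?thesis by (simp add: mult_ac)
qed

lemma coeff_in_dual: "coeff x y \<in> dual_space A"
proof -
  have "linear_functional_on A (coeff x y)"
    unfolding linear_functional_on_def
    by (simp add: coeff_def A_closed \<pi>_rules blinfun.add_left cinner_add_left scaleC_op.rep_eq
        cinner_scaleC_left)
  thus ?thesis
    using cmod_coeff_le[of _ x y]
    by (auto simp: dual_space_def bounded_functional_on_def coeff_def)
qed

lemma L_in_dual: "\<phi> \<in> dual_space A \<Longrightarrow> L \<phi> \<in> dual_space A"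
  using L_map by (auto simp: bounded_linear_map_on_dual_def)

lemma sing_in_dual: "sing x y \<in> dual_space A"
  unfolding sing_def by (intro dual_space_diff coeff_in_dual L_in_dual)

lemma dual_norm_coeff_le: "dual_norm A (coeff x y) \<le> norm x * norm y"
  by (rule dual_norm_le[OF A]) (simp_all add: cmod_coeff_le)

lemma cmod_sing_le: "cmod (sing x y a) \<le> norm x * norm y * norm a"
proof (cases "a \<in> A")
  case True
  have "dual_norm A (sing x y) \<le> dual_norm A (coeff x y)"
    using L_norm[OF coeff_in_dual, of x y] dual_norm_nonneg[OF A L_in_dual[OF coeff_in_dual], of x y]
    by (simp add: sing_def)
  with dual_norm_coeff_le have "dual_norm A (sing x y) \<le> norm x * norm y" by (rule order_trans[rotated])
  hence "dual_norm A (sing x y) * norm a \<le> norm x * norm y * norm a"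
    by (intro mult_right_mono) simp_all
  thus ?thesis using cmod_le_dual_norm[OF A sing_in_dual True, of x y] by linarith
next
  case False
  then show ?thesis using sing_in_dual[of x y] by (simp add: dual_space_def)
qed

lemma coeff_linear:
  "coeff (x + x') y = (\<lambda>a. coeff x y a + coeff x' y a)"
  "coeff x (y + y') = (\<lambda>a. coeff x y a + coeff x y' a)"
  "coeff (c *\<^sub>C x) y = (\<lambda>a. c * coeff x y a)"
  "coeff x (c *\<^sub>C y) = (\<lambda>a. cnj c * coeff x y a)"
  by (auto simp: coeff_def fun_eq_iff blinfun.add_right cinner_add_left cinner_add_right
      bounded_opsD[OF \<pi>_rules(1)] cinner_scaleC_left cinner_scaleC_right)

lemma sesquilinear_sing: "sesquilinear (\<lambda>x y. sing x y a)"
proof -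
  have L_add: "L (\<lambda>a. \<phi> a + \<psi> a) = (\<lambda>a. L \<phi> a + L \<psi> a)"
    if "\<phi> \<in> dual_space A" "\<psi> \<in> dual_space A" for \<phi> \<psi>
    using L_map that by (auto simp: bounded_linear_map_on_dual_def)
  have L_scale: "L (\<lambda>a. c * \<phi> a) = (\<lambda>a. c * L \<phi> a)" if "\<phi> \<in> dual_space A" for \<phi> c
    using L_map that by (auto simp: bounded_linear_map_on_dual_def)
  show ?thesis
    unfolding sesquilinear_def sing_def coeff_linear
    by (simp add: L_add L_scale coeff_in_dual algebra_simps)
qed

lemma abs_continuous_coeff_iff:
  "abs_continuous_functional W A (coeff x y) \<longleftrightarrow> sing x y = (\<lambda>a. 0)"
proof
  assume "abs_continuous_functional W A (coeff x y)"
  hence "coeff x y \<in> L ` dual_space A"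
    unfolding L_range AC_space_def using coeff_in_dual by blast
  then obtain \<phi> where "\<phi> \<in> dual_space A" "coeff x y = L \<phi>" by blast
  hence "L (coeff x y) = coeff x y" by (simp add: L_idem)
  thus "sing x y = (\<lambda>a. 0)" by (simp add: sing_def)
next
  assume "sing x y = (\<lambda>a. 0)"
  hence "coeff x y = L (coeff x y)" by (simp add: sing_def fun_eq_iff)
  hence "coeff x y \<in> AC_space W A" using L_range coeff_in_dual by blast
  thus "abs_continuous_functional W A (coeff x y)" by (simp add: AC_space_def)
qed

text \<open>The norm of \<open>coeff x x\<close> is at most \<open>\<parallel>x\<parallel>\<^sup>2\<close>, its value at the identity, and is the sum of the norms
  of the absolutely continuous and the singular part. As the value of the former at the identity
  cannot exceed its norm, the value of the latter cannot fall below its norm.\<close>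

lemma dual_norm_sing_diag: "dual_norm A (sing x x) \<le> Re (sing x x id_blinfun)"
proof -
  let ?l = "L (coeff x x)"
  have norm_one: "norm (id_blinfun :: 'k \<Rightarrow>\<^sub>L 'k) \<le> 1" by (rule norm_blinfun_bound) simp_all
  have "Re (?l id_blinfun) \<le> cmod (?l id_blinfun)" by (rule complex_Re_le_cmod)
  also have "\<dots> \<le> dual_norm A ?l * norm (id_blinfun :: 'k \<Rightarrow>\<^sub>L 'k)"
    by (rule cmod_le_dual_norm[OF A L_in_dual[OF coeff_in_dual] one])
  also have "\<dots> \<le> dual_norm A ?l"
    using norm_one dual_norm_nonneg[OF A L_in_dual[OF coeff_in_dual]] by (rule mult_left_le)
  finally have "Re (?l id_blinfun) \<le> dual_norm A ?l" .
  moreover have "dual_norm A ?l + dual_norm A (sing x x) \<le> norm x * norm x"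
    using L_norm[OF coeff_in_dual, of x x] dual_norm_coeff_le[of x x] by (simp add: sing_def)
  moreover have "Re (coeff x x id_blinfun) = norm x * norm x"
    by (simp add: coeff_def one \<pi>_rules cinner_self power2_eq_square)
  ultimately show ?thesis by (simp add: sing_def)
qed

text \<open>By the previous bound every form \<open>sing\<close> evaluated at \<open>a\<close> is dominated by the one evaluated at the
  identity, and \<open>x\<close> is a null vector of the latter.\<close>

lemma ac_vectorsI:
  assumes "abs_continuous_functional W A (coeff x x)"
  shows "x \<in> ac_vectors"
proof -
  have dom: "cmod (sing z z a) \<le> norm a * Re (sing z z id_blinfun)" for z a
  proof (cases "a \<in> A")
    case True
    have "cmod (sing z z a) \<le> dual_norm A (sing z z) * norm a"
      by (rule cmod_le_dual_norm[OF A sing_in_dual True])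
    also have "\<dots> \<le> Re (sing z z id_blinfun) * norm a"
      by (intro mult_right_mono dual_norm_sing_diag) simp
    finally show ?thesis by (simp add: mult.commute)
  next
    case False
    hence "sing z z a = 0" using sing_in_dual[of z z] by (simp add: dual_space_def)
    moreover have "0 \<le> Re (sing z z id_blinfun)"
      using dual_norm_nonneg[OF A sing_in_dual] dual_norm_sing_diag by (rule order_trans)
    ultimately show ?thesis by simp
  qed
  have null: "sing x x id_blinfun = 0" using assms by (simp add: abs_continuous_coeff_iff)
  show ?thesis
    unfolding ac_vectors_def
    using dominated_sesquilinear_left_null[OF sesquilinear_sing sesquilinear_sing dom null]
      dominated_sesquilinear_right_null[OF sesquilinear_sing sesquilinear_sing dom null]
    by blast
qed

lemma ac_vectorsD:
  assumes "x \<in> ac_vectors"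
  shows "abs_continuous_functional W A (coeff x y)" "abs_continuous_functional W A (coeff y x)"
  using assms by (auto simp: abs_continuous_coeff_iff ac_vectors_def fun_eq_iff)

lemma ac_vectors_subspace:
  "0 \<in> ac_vectors" "x \<in> ac_vectors \<Longrightarrow> y \<in> ac_vectors \<Longrightarrow> x + y \<in> ac_vectors"
  "x \<in> ac_vectors \<Longrightarrow> c *\<^sub>C x \<in> ac_vectors"
proof -
  show "0 \<in> ac_vectors"
    using cmod_sing_le[of 0] cmod_sing_le[of _ 0] by (simp add: ac_vectors_def)
qed (use sesquilinear_sing in \<open>simp_all add: ac_vectors_def sesquilinear_def\<close>)

lemma closed_ac_vectors: "closed ac_vectors"
proof -
  note ses = sesquilinear_sing[unfolded sesquilinear_def]
  have "bounded_linear (\<lambda>x. sing x y a)" for y a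
    by (rule bounded_linear_intro[where K = "norm y * norm a"])
      (use ses cmod_sing_le[of _ y a] in \<open>simp_all add: scaleR_scaleC scaleC_complex_def mult_ac\<close>)
  moreover have "bounded_linear (\<lambda>x. sing y x a)" for y a
    by (rule bounded_linear_intro[where K = "norm y * norm a"])
      (use ses cmod_sing_le[of y _ a] in \<open>simp_all add: scaleR_scaleC scaleC_complex_def mult_ac\<close>)
  ultimately show ?thesis
    unfolding ac_vectors_def
    by (intro closed_Collect_all closed_Collect_conj closed_Collect_eq
        linear_continuous_on continuous_on_const)
qed

text \<open>In each of the following invariance proofs the coefficient of the image vector is rewritten as a
  coefficient, possibly translated by \<open>a\<close>, in which \<open>x\<close> is one of the two vectors.\<close>

lemma ac_vectors_image:
  assumes a: "a \<in> A" and x: "x \<in> ac_vectors"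
  shows "\<pi> a x \<in> ac_vectors"
proof (rule ac_vectorsI, rule abs_continuous_functional_cong[OF A])
  show "abs_continuous_functional W A (\<lambda>b. coeff x (\<pi> a x) (b o\<^sub>L a))"
    by (rule abs_continuous_functional_mult_right[OF W A AW ac_vectorsD(1)[OF x] a])
  show "coeff x (\<pi> a x) (b o\<^sub>L a) = coeff (\<pi> a x) (\<pi> a x) b" if "b \<in> A" for b
    using that a by (simp add: coeff_def A_closed \<pi>_rules)
qed

lemma ac_vectors_adjoint_image:
  assumes a: "a \<in> A" and S: "is_adjoint (\<pi> a) S" and x: "x \<in> ac_vectors"
  shows "S x \<in> ac_vectors"
proof (rule ac_vectorsI, rule abs_continuous_functional_cong[OF A])
  show "abs_continuous_functional W A (\<lambda>b. coeff (S x) x (a o\<^sub>L b))"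
    by (rule abs_continuous_functional_mult_left[OF W A AW ac_vectorsD(2)[OF x] a])
  show "coeff (S x) x (a o\<^sub>L b) = coeff (S x) (S x) b" if "b \<in> A" for b
    using that a S by (simp add: coeff_def A_closed \<pi>_rules is_adjoint_def)
qed

lemma ac_vectors_commutant:
  assumes T: "T \<in> commutant (\<pi> ` A)" and S: "is_adjoint T S" and x: "x \<in> ac_vectors"
  shows "T x \<in> ac_vectors" "S x \<in> ac_vectors"
proof -
  have comm: "T (\<pi> b z) = \<pi> b (T z)" if "b \<in> A" for b z
  proof -
    have "T o\<^sub>L \<pi> b = \<pi> b o\<^sub>L T" using T that by (simp add: commutant_def)
    from arg_cong[OF this, of "\<lambda>R. blinfun_apply R z"] show ?thesis by simp
  qed
  show "T x \<in> ac_vectors"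
  proof (rule ac_vectorsI, rule abs_continuous_functional_cong[OF A])
    show "abs_continuous_functional W A (coeff x (S (T x)))" by (rule ac_vectorsD(1)[OF x])
    show "coeff x (S (T x)) b = coeff (T x) (T x) b" if "b \<in> A" for b
      using that S by (simp add: coeff_def comm[symmetric] is_adjoint_def)
  qed
  show "S x \<in> ac_vectors"
  proof (rule ac_vectorsI, rule abs_continuous_functional_cong[OF A])
    show "abs_continuous_functional W A (coeff (T (S x)) x)" by (rule ac_vectorsD(2)[OF x])
    show "coeff (T (S x)) x b = coeff (S x) (S x) b" if "b \<in> A" for b
      using that S by (simp add: coeff_def comm[symmetric] is_adjoint_def)
  qed
qed

lemma cstar_generated_reduces_ac_vectors:
  "cstar_generated (\<pi> ` A \<union> commutant (\<pi> ` A)) \<subseteq> reducing_ops ac_vectors"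
proof -
  have "\<pi> a \<in> reducing_ops ac_vectors" if a: "a \<in> A" for a
  proof -
    obtain S where S: "is_adjoint (\<pi> a) S" using \<pi>_rules(1)[OF a] by (rule adjoint_exists)
    from \<pi>_rules(1)[OF a] S show ?thesis
      by (rule reducing_opsI) (fact ac_vectors_image[OF a] ac_vectors_adjoint_image[OF a S])+
  qed
  moreover have "T \<in> reducing_ops ac_vectors" if T: "T \<in> commutant (\<pi> ` A)" for T
  proof -
    have "T \<in> bounded_ops" using T by (simp add: commutant_def)
    then obtain S where S: "is_adjoint T S" by (rule adjoint_exists)
    from \<open>T \<in> bounded_ops\<close> S show ?thesis
      by (rule reducing_opsI) (fact ac_vectors_commutant[OF T S])+
  qed
  moreover have "cstar_subalgebra (reducing_ops ac_vectors)"
    by (rule cstar_subalgebra_reducing_ops) (simp_all add: ac_vectors_subspace closed_ac_vectors)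
  ultimately show ?thesis unfolding cstar_generated_def by blast
qed

lemma abs_continuous_rep_if_cyclic:
  assumes cyc: "cyclic_vector (cstar_generated (\<pi> ` A \<union> commutant (\<pi> ` A))) \<xi>"
    and \<xi>: "abs_continuous_functional W A (coeff \<xi> \<xi>)"
  shows "abs_continuous_rep W A \<pi>"
  unfolding abs_continuous_rep_def
proof
  fix x
  let ?B = "cstar_generated (\<pi> ` A \<union> commutant (\<pi> ` A))"
  have "(\<lambda>T. blinfun_apply T \<xi>) ` ?B \<subseteq> ac_vectors"
    using cstar_generated_reduces_ac_vectors ac_vectorsI[OF \<xi>] by (auto simp: reducing_ops_def)
  hence "closure ((\<lambda>T. blinfun_apply T \<xi>) ` ?B) \<subseteq> ac_vectors"
    by (rule closure_minimal[OF _ closed_ac_vectors])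
  hence "x \<in> ac_vectors" using cyc by (auto simp: cyclic_vector_def)
  from ac_vectorsD(1)[OF this, of x]
  show "abs_continuous_functional W A (\<lambda>a. cinner (\<pi> a x) x)"
    by (rule abs_continuous_functional_cong[OF A, rotated]) (simp add: coeff_def)
qed

end

theorem theorem7p2:
  fixes W A :: "('k::chilbert_space \<Rightarrow>\<^sub>L 'k) set"
    and \<pi> :: "('k \<Rightarrow>\<^sub>L 'k) \<Rightarrow> ('h::chilbert_space \<Rightarrow>\<^sub>L 'h)"
    and \<xi> :: 'h
    and \<psi> :: "('k \<Rightarrow>\<^sub>L 'k) \<Rightarrow> complex"
  assumes "von_neumann_algebra W"
    and "unital_subalgebra A"
    and "A \<subseteq> W"
    and "admits_lebesgue_decomposition W A"
    and "unital_homomorphism A \<pi>"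
    and "contractive_on A \<pi>"
    and "norm \<xi> = 1"
    and "cyclic_vector (cstar_generated (\<pi> ` A \<union> commutant (\<pi> ` A))) \<xi>"
    and "\<And>a. a \<in> A \<Longrightarrow> \<psi> a = cinner (\<pi> a \<xi>) \<xi>"
  shows "abs_continuous_rep W A \<pi> \<longleftrightarrow> abs_continuous_functional W A \<psi>"
proof
  have A: "subalgebra A" using assms(2) by (simp add: unital_subalgebra_def)
  {
    assume "abs_continuous_rep W A \<pi>"
    hence "abs_continuous_functional W A (\<lambda>a. cinner (\<pi> a \<xi>) \<xi>)"
      by (simp add: abs_continuous_rep_def)
    thus "abs_continuous_functional W A \<psi>"
      by (rule abs_continuous_functional_cong[OF A, rotated]) (simp add: assms(9))
  }
  assume \<psi>: "abs_continuous_functional W A \<psi>"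
  obtain L where L: "bounded_linear_map_on_dual A L"
      "\<forall>\<phi>\<in>dual_space A. L (L \<phi>) = L \<phi>" "L ` dual_space A = AC_space W A"
      "\<forall>\<phi>\<in>dual_space A. dual_norm A \<phi> = dual_norm A (L \<phi>) + dual_norm A (\<lambda>a. \<phi> a - L \<phi> a)"
    using assms(4) unfolding admits_lebesgue_decomposition_def by blast
  interpret lebesgue_decomposed_rep W A L \<pi>
    using assms(1-3,5,6) L
    by unfold_locales (auto simp: von_neumann_algebra_def unital_subalgebra_def)
  show "abs_continuous_rep W A \<pi>"
  proof (rule abs_continuous_rep_if_cyclic[OF assms(8)])
    show "abs_continuous_functional W A (coeff \<xi> \<xi>)"
      by (rule abs_continuous_functional_cong[OF A _ \<psi>]) (simp add: coeff_def assms(9))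
  qed
qed

end
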